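(* Let $m\le M$ be real numbers, let $x_1,\dots,x_n$ be real numbers with $m\le x_i\le M$ for $i=1,\dots,n$, and let $p_1,\dots,p_n\ge 0$ with $\sum_{i=1}^n p_i=1$. Let $\mu_1'=\sum_{i=1}^n p_i x_i$, $\mu_2=\sum_{i=1}^n p_i(x_i-\mu_1')^2$ and $\mu_4=\sum_{i=1}^n p_i(x_i-\mu_1')^4$. Then $$\mu_4+3\mu_2^2\le (M-m)^2(\mu_1'-m)(M-\mu_1')\le \frac{(M-m)^4}{4}.$$
   Context: The numbers $x_i$ are the values of a discrete random variable, taken with probabilities $p_i$; $\mu_1'$ is its mean and $\mu_r$ its $r$-th central moment. *)

theory Defs
  imports Complex_Main
begin

definition dmean :: "nat \<Rightarrow> (nat \<Rightarrow> real) \<Rightarrow> (nat \<Rightarrow> real) \<Rightarrow> real" where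
  "dmean n p x = (\<Sum>i=1..n. p i * x i)"

definition central_moment :: "nat \<Rightarrow> (nat \<Rightarrow> real) \<Rightarrow> (nat \<Rightarrow> real) \<Rightarrow> nat \<Rightarrow> real" where
  "central_moment n p x r = (\<Sum>i=1..n. p i * (x i - dmean n p x) ^ r)"

end

theory Submission
  imports Defs
begin

text \<open>
  Write \<open>y = X - \<mu>\<^sub>1'\<close>, a centred variable with values in \<open>[-b, a]\<close>,
  where \<open>a = M - \<mu>\<^sub>1'\<close> and \<open>b = \<mu>\<^sub>1' - m\<close>. Bounding \<open>y\<^sup>2\<close> and \<open>y\<^sup>4\<close>
  by their chords over this interval and averaging gives \<open>\<mu>\<^sub>2 \<le> a b\<close> and
  \<open>\<mu>\<^sub>4 \<le> a b (a\<^sup>2 - a b + b\<^sup>2)\<close>, and the latter plus \<open>3 (a b)\<^sup>2\<close> is exactly \<open>(a + b)\<^sup>2 a b\<close>.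
\<close>

lemma sum_centred:
  assumes "(\<Sum>i=1..n. p i) = 1"
  shows "(\<Sum>i=1..n. p i * (x i - dmean n p x)) = 0"
proof -
  have "(\<Sum>i=1..n. p i * (x i - dmean n p x))
      = (\<Sum>i=1..n. p i * x i) - (\<Sum>i=1..n. p i) * dmean n p x"
    by (simp add: right_diff_distrib sum_subtractf sum_distrib_right)
  then show ?thesis
    using assms by (simp add: dmean_def)
qed

text \<open>The weights are nonnegative and sum to 1, so the bound survives averaging. The linear
  term averages to 0 by \<open>sum_centred\<close>, so the slope \<open>d\<close> is
  arbitrary.\<close>

lemma central_moment_le_affine:
  assumes "\<And>i. i \<in> {1..n} \<Longrightarrow> 0 \<le> p i" and "(\<Sum>i=1..n. p i) = 1"
    and "\<And>i. i \<in> {1..n} \<Longrightarrow> (x i - dmean n p x) ^ r \<le> c + d * (x i - dmean n p x)"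
  shows "central_moment n p x r \<le> c"
proof -
  have "central_moment n p x r \<le> (\<Sum>i=1..n. p i * (c + d * (x i - dmean n p x)))"
    unfolding central_moment_def by (intro sum_mono mult_left_mono assms)
  also have "\<dots> = (\<Sum>i=1..n. p i) * c + d * (\<Sum>i=1..n. p i * (x i - dmean n p x))"
    by (simp add: distrib_left sum.distrib sum_distrib_left sum_distrib_right mult_ac)
  also have "\<dots> = c"
    by (simp add: assms(2) sum_centred[OF assms(2)] del: One_nat_def)
  finally show ?thesis .
qed

text \<open>Chord minus parabola is exactly \<open>(a - y) * (y + b)\<close>.\<close>

lemma power2_le_chord:
  fixes a b y :: real
  assumes "-b \<le> y" "y \<le> a"
  shows "y ^ 2 \<le> a * b + (a - b) * y"
proof -
  have "0 \<le> (a - y) * (y + b)"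
    using assms by simp
  then show ?thesis
    by (simp add: algebra_simps power2_eq_square)
qed

text \<open>Chord minus quartic vanishes at \<open>y = a\<close> and \<open>y = -b\<close>, hence
  has the factor \<open>(a - y) * (y + b)\<close>. The remaining quadratic factor is half a sum of
  squares.\<close>

lemma power4_le_chord:
  fixes a b y :: real
  assumes "-b \<le> y" "y \<le> a"
  shows "y ^ 4 \<le> a * b * (a\<^sup>2 - a * b + b\<^sup>2) + (a - b) * (a\<^sup>2 + b\<^sup>2) * y"
proof -
  have "y\<^sup>2 + (a - b) * y + (a\<^sup>2 - a * b + b\<^sup>2) = ((y + a - b)\<^sup>2 + y\<^sup>2 + a\<^sup>2 + b\<^sup>2) / 2"
    by (simp add: field_simps power2_eq_square)
  also have "\<dots> \<ge> 0"
    by simp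
  finally have "0 \<le> y\<^sup>2 + (a - b) * y + (a\<^sup>2 - a * b + b\<^sup>2)" .
  then have "0 \<le> (a - y) * (y + b) * (y\<^sup>2 + (a - b) * y + (a\<^sup>2 - a * b + b\<^sup>2))"
    using assms by simp
  also have "\<dots> = a * b * (a\<^sup>2 - a * b + b\<^sup>2) + (a - b) * (a\<^sup>2 + b\<^sup>2) * y - y ^ 4"
    by algebra
  finally show ?thesis
    by simp
qed

theorem corollary2p2:
  fixes m M :: real and n :: nat and x p :: "nat \<Rightarrow> real"
  assumes "m \<le> M"
    and "\<And>i. i \<in> {1..n} \<Longrightarrow> m \<le> x i \<and> x i \<le> M"
    and "\<And>i. i \<in> {1..n} \<Longrightarrow> 0 \<le> p i"
    and "(\<Sum>i=1..n. p i) = 1"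
  shows "central_moment n p x 4 + 3 * (central_moment n p x 2)\<^sup>2
           \<le> (M - m)\<^sup>2 * (dmean n p x - m) * (M - dmean n p x) \<and>
         (M - m)\<^sup>2 * (dmean n p x - m) * (M - dmean n p x) \<le> (M - m) ^ 4 / 4"
proof
  define a where "a = M - dmean n p x"
  define b where "b = dmean n p x - m"
  have Mm: "M - m = a + b"
    by (simp add: a_def b_def)
  have range: "-b \<le> x i - dmean n p x" "x i - dmean n p x \<le> a" if "i \<in> {1..n}" for i
    using assms(2)[OF that] by (simp_all add: a_def b_def)
  have \<mu>2: "central_moment n p x 2 \<le> a * b"
    by (rule central_moment_le_affine[OF assms(3,4) power2_le_chord[OF range]])
  have \<mu>4: "central_moment n p x 4 \<le> a * b * (a\<^sup>2 - a * b + b\<^sup>2)"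
    by (rule central_moment_le_affine[OF assms(3,4) power4_le_chord[OF range]])
  \<comment> \<open>Nonnegativity allows the bound on the second moment to be squared.\<close>
  have "0 \<le> central_moment n p x 2"
    unfolding central_moment_def by (intro sum_nonneg mult_nonneg_nonneg assms(3)) auto
  then have "(central_moment n p x 2)\<^sup>2 \<le> (a * b)\<^sup>2"
    using \<mu>2 by (intro power_mono)
  with \<mu>4 have "central_moment n p x 4 + 3 * (central_moment n p x 2)\<^sup>2
      \<le> a * b * (a\<^sup>2 - a * b + b\<^sup>2) + 3 * (a * b)\<^sup>2"
    by linarith
  also have "\<dots> = (a + b)\<^sup>2 * b * a"
    by algebra
  finally show "central_moment n p x 4 + 3 * (central_moment n p x 2)\<^sup>2
      \<le> (M - m)\<^sup>2 * (dmean n p x - m) * (M - dmean n p x)"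
    by (simp only: Mm flip: a_def b_def)
  \<comment> \<open>This is the AM-GM gap \<open>(a + b)^2 / 4 - a * b = (a - b)^2 / 4\<close>,
    scaled by \<open>(a + b)^2\<close>.\<close>
  have "(a + b) ^ 4 / 4 - (a + b)\<^sup>2 * b * a = ((a + b) * (a - b))\<^sup>2 / 4"
    by (simp add: field_simps) algebra
  moreover have "0 \<le> ((a + b) * (a - b))\<^sup>2 / 4"
    by simp
  ultimately have "(a + b)\<^sup>2 * b * a \<le> (a + b) ^ 4 / 4"
    by linarith
  then show "(M - m)\<^sup>2 * (dmean n p x - m) * (M - dmean n p x) \<le> (M - m) ^ 4 / 4"
    by (simp only: Mm flip: a_def b_def)
qed

end
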